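(* Let $G$ and $G'$ be connected simple graphs, both with maximum degree $\Delta$, let $f:G'\to G$ be an $r$-fold covering graph map, where $r$ is a positive integer, and let $\mu:V(G)\cup E(G)\to\chi(\Delta)$ be a semi-total coloring (sTC) of $G$. Then there exists an sTC $\mu':V(G')\cup E(G')\to\chi(\Delta)$ of $G'$ that is a lifting of $\mu$ and satisfies $\beta(\mu')=r\,\beta(\mu)$ and $\gamma(\mu')=r\,\gamma(\mu)$. If $\mu$ is a total coloring (TC), then so is $\mu'$. If $\mu$ is an equitable total coloring (EqTC) and $\gamma(\mu)=0$, then $\mu'$ is an EqTC.
   Context: For a connected simple graph $G$ with maximum degree $\Delta$, the color set is $\chi(\Delta)=\{1,2,\ldots,\Delta+1\}$. A semi-total coloring (sTC) of $G$ is a function $\mu:V(G)\cup E(G)\to\chi(\Delta)$ such that every two adjacent edges have distinct colors and every vertex has a color distinct from the colors of its incident edges. A total coloring (TC) with colors in $\chi(\Delta)$ is an sTC in which, in addition, adjacent vertices have distinct colors. An edge whose endvertices have the same color is a $\beta$-edge; $\beta(\mu)$ is the number of $\beta$-edges. The $\mu$-class of a color $i\in\chi(\Delta)$ is the set of elements of $V(G)\cup E(G)$ assigned color $i$; $\gamma(\mu)$ is the difference between the maximum and minimum cardinalities of the $\mu$-classes over all colors in $\chi(\Delta)$. A TC is equitable (an EqTC) if the cardinalities of every two of its color classes differ by at most 1. For graphs $G=(V,E)$ and $G'=(V',E')$, let $N_G(v)$ denote the set of vertices of $G$ adjacent to $v$. A covering graph map $f=(f_V,f_E):G'\to G$ consists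 of surjections $f_V:V'\to V$ and $f_E:E'\to E$ with $f_E(vw)=f_V(v)f_V(w)$ for every $vw\in E'$, such that for every $v\in V'$ the restriction of $f_V$ to $N_{G'}(v)$ is a bijection onto $N_G(f_V(v))$. It is $r$-fold if $|f_V^{-1}(v)|=r$ for every $v\in V$. An sTC $\mu'$ of $G'$ is a lifting of the sTC $\mu$ of $G$ if $\mu'(v')=\mu(f_V(v'))$ for all $v'\in V'$ and $\mu'(e')=\mu(f_E(e'))$ for all $e'\in E'$. *)

theory Defs
  imports Main "HOL-Library.FuncSet"
begin

record 'a ugraph =
  verts :: "'a set"
  edges :: "'a set set"

definition simple_graph :: "'a ugraph \<Rightarrow> bool" where
  "simple_graph G \<longleftrightarrow> finite (verts G) \<and> (\<forall>e\<in>edges G. e \<subseteq> verts G \<and> card e = 2)"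

definition connected_graph :: "'a ugraph \<Rightarrow> bool" where
  "connected_graph G \<longleftrightarrow> verts G \<noteq> {} \<and>
     (\<forall>u\<in>verts G. \<forall>v\<in>verts G. (u, v) \<in> {(x, y). {x, y} \<in> edges G}\<^sup>*)"

definition nbhd :: "'a ugraph \<Rightarrow> 'a \<Rightarrow> 'a set" where
  "nbhd G v = {w \<in> verts G. {v, w} \<in> edges G}"

definition degree :: "'a ugraph \<Rightarrow> 'a \<Rightarrow> nat" where
  "degree G v = card {e \<in> edges G. v \<in> e}"

definition max_degree :: "'a ugraph \<Rightarrow> nat" where
  "max_degree G = Max (degree G ` verts G)"

definition color_set :: "nat \<Rightarrow> nat set" where
  "color_set D = {1..D + 1}"

text \<open>
  A coloring of the vertices and edges is a function on the disjoint sum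
  \<^term>\<open>verts G <+> edges G\<close>; its values outside this set are irrelevant.
\<close>

type_synonym 'a coloring = "'a + 'a set \<Rightarrow> nat"

definition is_sTC :: "'a ugraph \<Rightarrow> 'a coloring \<Rightarrow> bool" where
  "is_sTC G \<mu> \<longleftrightarrow>
     \<mu> \<in> (verts G <+> edges G) \<rightarrow> color_set (max_degree G) \<and>
     (\<forall>e\<in>edges G. \<forall>e'\<in>edges G. e \<noteq> e' \<and> e \<inter> e' \<noteq> {} \<longrightarrow> \<mu> (Inr e) \<noteq> \<mu> (Inr e')) \<and>
     (\<forall>v\<in>verts G. \<forall>e\<in>edges G. v \<in> e \<longrightarrow> \<mu> (Inl v) \<noteq> \<mu> (Inr e))"

definition is_TC :: "'a ugraph \<Rightarrow> 'a coloring \<Rightarrow> bool" where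
  "is_TC G \<mu> \<longleftrightarrow> is_sTC G \<mu> \<and>
     (\<forall>v\<in>verts G. \<forall>w\<in>verts G. {v, w} \<in> edges G \<longrightarrow> \<mu> (Inl v) \<noteq> \<mu> (Inl w))"

definition beta_edges :: "'a ugraph \<Rightarrow> 'a coloring \<Rightarrow> 'a set set" where
  "beta_edges G \<mu> = {e \<in> edges G. \<exists>v w. e = {v, w} \<and> \<mu> (Inl v) = \<mu> (Inl w)}"

definition beta :: "'a ugraph \<Rightarrow> 'a coloring \<Rightarrow> nat" where
  "beta G \<mu> = card (beta_edges G \<mu>)"

definition color_class :: "'a ugraph \<Rightarrow> 'a coloring \<Rightarrow> nat \<Rightarrow> ('a + 'a set) set" where
  "color_class G \<mu> i = {x \<in> verts G <+> edges G. \<mu> x = i}"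

definition gamma :: "'a ugraph \<Rightarrow> 'a coloring \<Rightarrow> nat" where
  "gamma G \<mu> =
     Max ((\<lambda>i. card (color_class G \<mu> i)) ` color_set (max_degree G)) -
     Min ((\<lambda>i. card (color_class G \<mu> i)) ` color_set (max_degree G))"

definition is_EqTC :: "'a ugraph \<Rightarrow> 'a coloring \<Rightarrow> bool" where
  "is_EqTC G \<mu> \<longleftrightarrow> is_TC G \<mu> \<and>
     (\<forall>i\<in>color_set (max_degree G). \<forall>j\<in>color_set (max_degree G).
        \<bar>int (card (color_class G \<mu> i)) - int (card (color_class G \<mu> j))\<bar> \<le> 1)"

definition covering_map ::
  "'b ugraph \<Rightarrow> 'a ugraph \<Rightarrow> ('b \<Rightarrow> 'a) \<Rightarrow> ('b set \<Rightarrow> 'a set) \<Rightarrow> bool" where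
  "covering_map G' G fV fE \<longleftrightarrow>
     fV ` verts G' = verts G \<and>
     fE ` edges G' = edges G \<and>
     (\<forall>v w. {v, w} \<in> edges G' \<longrightarrow> fE {v, w} = {fV v, fV w}) \<and>
     (\<forall>v\<in>verts G'. bij_betw fV (nbhd G' v) (nbhd G (fV v)))"

definition r_fold_covering_map ::
  "nat \<Rightarrow> 'b ugraph \<Rightarrow> 'a ugraph \<Rightarrow> ('b \<Rightarrow> 'a) \<Rightarrow> ('b set \<Rightarrow> 'a set) \<Rightarrow> bool" where
  "r_fold_covering_map r G' G fV fE \<longleftrightarrow>
     covering_map G' G fV fE \<and> (\<forall>v\<in>verts G. card {v' \<in> verts G'. fV v' = v} = r)"

definition is_lifting ::
  "'b ugraph \<Rightarrow> ('b \<Rightarrow> 'a) \<Rightarrow> ('b set \<Rightarrow> 'a set) \<Rightarrow> 'a coloring \<Rightarrow> 'b coloring \<Rightarrow> bool" where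
  "is_lifting G' fV fE \<mu> \<mu>' \<longleftrightarrow>
     (\<forall>v'\<in>verts G'. \<mu>' (Inl v') = \<mu> (Inl (fV v'))) \<and>
     (\<forall>e'\<in>edges G'. \<mu>' (Inr e') = \<mu> (Inr (fE e')))"

end

theory Submission
  imports Defs
begin

text \<open>
  The lifting is forced: it is the pullback of \<open>\<mu>\<close> along the covering, with the two
  parts of the covering combined into one map \<^term>\<open>map_sum fV fE\<close> on vertices and edges.
  Everything then follows from two properties of this map.

  \<^item> It is locally injective (\<open>covering_edge_map_adjacent\<close>): distinct edges of \<open>G'\<close> that meet
    in a vertex have distinct images that meet, because \<open>fV\<close> is injective on the neighbourhood of
    that vertex. So each local colour constraint in \<open>G'\<close> is the pullback of one in \<open>G\<close>.

  \<^item> It is \<open>r\<close>-to-one not only on vertices but also on edges (\<open>card_edge_fibre\<close>): if \<open>a\<close> is an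
    endvertex of \<open>e\<close>, then each vertex over \<open>a\<close> lies on exactly one edge over \<open>e\<close>, and each edge
    over \<open>e\<close> has exactly one endvertex over \<open>a\<close>.

  The \<open>\<beta>\<close>-edges and the colour classes of the pullback are preimages of those of \<open>\<mu>\<close>, so the
  second property multiplies all their cardinalities by \<open>r\<close>, and hence the spread \<open>\<gamma>\<close> too.
  When \<open>\<gamma>(\<mu>) = 0\<close> the spread of the pullback is again \<open>0\<close>, which is more than equitability.
\<close>

section \<open>Edges of simple graphs\<close>

lemma simple_graph_edgeE:
  assumes "simple_graph G" "e \<in> edges G"
  obtains x y where "e = {x, y}" "x \<noteq> y" "x \<in> verts G" "y \<in> verts G"
  using assms unfolding simple_graph_def card_2_iff by (metis insert_subset)

lemma simple_graph_edge_atE: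
  assumes "simple_graph G" "e \<in> edges G" "v \<in> e"
  obtains w where "e = {v, w}" "v \<noteq> w" "v \<in> verts G" "w \<in> nbhd G v"
  using assms(1,2)
proof (rule simple_graph_edgeE)
  fix x y
  assume "e = {x, y}" "x \<noteq> y" "x \<in> verts G" "y \<in> verts G"
  then show thesis
    using that assms(2,3) by (auto simp: nbhd_def insert_commute)
qed

lemma finite_edges:
  assumes "simple_graph G"
  shows "finite (edges G)"
proof (rule finite_subset)
  show "edges G \<subseteq> Pow (verts G)" "finite (Pow (verts G))"
    using assms by (auto simp: simple_graph_def)
qed

section \<open>Edges and fibres of a covering\<close>

lemma covering_edge_map_eq_image:
  assumes "simple_graph G'" "covering_map G' G fV fE" "e \<in> edges G'"
  shows "fE e = fV ` e"
  using assms(1,3)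
proof (rule simple_graph_edgeE)
  fix x y
  assume "e = {x, y}"
  then show ?thesis
    using assms(2,3) by (auto simp: covering_map_def)
qed

text \<open>
  This is where the covering condition is used for properness: an arbitrary graph homomorphism could
  fold two edges at a vertex onto one edge.
\<close>

lemma covering_edge_map_adjacent:
  assumes "simple_graph G'" "covering_map G' G fV fE"
    and "e \<in> edges G'" "e' \<in> edges G'" "e \<noteq> e'" "e \<inter> e' \<noteq> {}"
  shows "fE e \<noteq> fE e'" "fE e \<inter> fE e' \<noteq> {}"
proof -
  obtain v where v: "v \<in> e" "v \<in> e'"
    using assms(6) by blast
  obtain x where x: "e = {v, x}" "v \<in> verts G'" "x \<in> nbhd G' v"
    using simple_graph_edge_atE[OF assms(1,3) v(1)] by metis
  obtain y where y: "e' = {v, y}" "y \<in> nbhd G' v"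
    using simple_graph_edge_atE[OF assms(1,4) v(2)] by metis
  have "inj_on fV (nbhd G' v)"
    using assms(2) x(2) by (auto simp: covering_map_def bij_betw_def)
  then have "fV x \<noteq> fV y"
    using x y assms(5) by (auto dest: inj_onD)
  moreover have "fE e = {fV v, fV x}" "fE e' = {fV v, fV y}"
    using covering_edge_map_eq_image[OF assms(1,2)] assms(3,4) x y by auto
  ultimately show "fE e \<noteq> fE e'" "fE e \<inter> fE e' \<noteq> {}"
    by (auto simp: doubleton_eq_iff)
qed

text \<open>
  The bijection from the fibre of an endvertex \<open>a\<close> sends \<open>v\<close> to the edge that joins \<open>v\<close> to its
  unique neighbour over the other endvertex \<open>b\<close>. Its inverse picks the endvertex over \<open>a\<close>, which
  is unique because \<open>a \<noteq> b\<close>.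
\<close>

lemma card_edge_fibre:
  assumes G: "simple_graph G" and G': "simple_graph G'"
    and cov: "covering_map G' G fV fE"
    and e: "e \<in> edges G" "a \<in> e"
  shows "card {e' \<in> edges G'. fE e' = e} = card {v \<in> verts G'. fV v = a}"
proof -
  obtain b where ab: "e = {a, b}" "a \<noteq> b" "b \<in> nbhd G a"
    using simple_graph_edge_atE[OF G e] by metis
  define lift where "lift v = inv_into (nbhd G' v) fV b" for v
  have bij: "bij_betw fV (nbhd G' v) (nbhd G a)" if "v \<in> verts G'" "fV v = a" for v
    using cov that by (auto simp: covering_map_def)
  have lift: "lift v \<in> nbhd G' v" "fV (lift v) = b" if "v \<in> verts G'" "fV v = a" for v
    using bij[OF that] ab(3) unfolding lift_def bij_betw_def
    by (auto intro: inv_into_into f_inv_into_f)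
  have lift_eq: "lift v = w" if "v \<in> verts G'" "fV v = a" "w \<in> nbhd G' v" "fV w = b" for v w
    using bij[OF that(1,2)] that(3,4) unfolding lift_def bij_betw_def
    by (auto intro: inv_into_f_eq)
  have "bij_betw (\<lambda>v. {v, lift v}) {v \<in> verts G'. fV v = a} {e' \<in> edges G'. fE e' = e}"
  proof (rule bij_betw_imageI)
    show "inj_on (\<lambda>v. {v, lift v}) {v \<in> verts G'. fV v = a}"
    proof (rule inj_onI)
      fix v v' assume v: "v \<in> {v \<in> verts G'. fV v = a}" "v' \<in> {v \<in> verts G'. fV v = a}"
        and "{v, lift v} = {v', lift v'}"
      moreover have "v \<noteq> lift v'"
        using lift(2)[of v'] v ab(2) by auto
      ultimately show "v = v'"
        by (auto simp: doubleton_eq_iff)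
    qed
    show "(\<lambda>v. {v, lift v}) ` {v \<in> verts G'. fV v = a} = {e' \<in> edges G'. fE e' = e}"
    proof (intro equalityI subsetI)
      fix e' assume "e' \<in> (\<lambda>v. {v, lift v}) ` {v \<in> verts G'. fV v = a}"
      then obtain v where v: "v \<in> verts G'" "fV v = a" and e': "e' = {v, lift v}"
        by blast
      have "e' \<in> edges G'"
        using lift(1)[OF v] e' by (simp add: nbhd_def)
      moreover have "fE e' = e"
        using covering_edge_map_eq_image[OF G' cov \<open>e' \<in> edges G'\<close>] lift(2)[OF v] v e' ab(1)
        by simp
      ultimately show "e' \<in> {e' \<in> edges G'. fE e' = e}"
        by simp
    next
      fix e' assume "e' \<in> {e' \<in> edges G'. fE e' = e}"
      then have e': "e' \<in> edges G'" "fV ` e' = {a, b}"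
        using covering_edge_map_eq_image[OF G' cov] ab(1) by auto
      from e'(2) obtain v where v: "v \<in> e'" "fV v = a"
        by (metis imageE insertI1)
      obtain w where w: "e' = {v, w}" "v \<in> verts G'" "w \<in> nbhd G' v"
        using simple_graph_edge_atE[OF G' e'(1) v(1)] by metis
      have "fV w = b"
        using e'(2) v(2) w(1) ab(2) by (auto simp: doubleton_eq_iff)
      then show "e' \<in> (\<lambda>v. {v, lift v}) ` {v \<in> verts G'. fV v = a}"
        using lift_eq[OF w(2) v(2) w(3)] v(2) w by auto
    qed
  qed
  then show ?thesis
    by (rule bij_betw_same_card[symmetric])
qed

lemma card_preimage_constant_fibres:
  assumes "finite X" "finite S"
    and "\<And>y. y \<in> S \<Longrightarrow> card {x \<in> X. f x = y} = r"
  shows "card {x \<in> X. f x \<in> S} = r * card S"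
proof -
  have "{x \<in> X. f x \<in> S} = (\<Union>y\<in>S. {x \<in> X. f x = y})"
    by auto
  also have "card \<dots> = (\<Sum>y\<in>S. card {x \<in> X. f x = y})"
    using assms(1,2) by (intro card_UN_disjoint) auto
  finally show ?thesis
    using assms(3) by simp
qed

lemma r_fold_covering_edge_fibres:
  assumes "simple_graph G" "simple_graph G'" "r_fold_covering_map r G' G fV fE" "e \<in> edges G"
  shows "card {e' \<in> edges G'. fE e' = e} = r"
  using assms(1,4)
proof (rule simple_graph_edgeE)
  fix a b
  assume "e = {a, b}" "a \<in> verts G"
  then show ?thesis
    using card_edge_fibre[of G G' fV fE e a] assms by (simp add: r_fold_covering_map_def)
qed

section \<open>Pulling back a colouring\<close>

definition pullback :: "('b \<Rightarrow> 'a) \<Rightarrow> ('b set \<Rightarrow> 'a set) \<Rightarrow> 'a coloring \<Rightarrow> 'b coloring" where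
  "pullback fV fE \<mu> = \<mu> \<circ> map_sum fV fE"

lemma pullback_simps [simp]:
  "pullback fV fE \<mu> (Inl v) = \<mu> (Inl (fV v))"
  "pullback fV fE \<mu> (Inr e) = \<mu> (Inr (fE e))"
  by (simp_all add: pullback_def)

lemma is_sTC_pullback:
  assumes G': "simple_graph G'" and cov: "covering_map G' G fV fE"
    and deg: "max_degree G' = max_degree G" and "is_sTC G \<mu>"
  shows "is_sTC G' (pullback fV fE \<mu>)"
proof -
  have V: "fV v \<in> verts G" if "v \<in> verts G'" for v
    using cov that by (auto simp: covering_map_def)
  have E: "fE e \<in> edges G" if "e \<in> edges G'" for e
    using cov that by (auto simp: covering_map_def)
  have range: "\<mu> \<in> (verts G <+> edges G) \<rightarrow> color_set (max_degree G)"
    and edges: "\<And>e e'. e \<in> edges G \<Longrightarrow> e' \<in> edges G \<Longrightarrow> e \<noteq> e' \<Longrightarrow> e \<inter> e' \<noteq> {} \<Longrightarrow>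
      \<mu> (Inr e) \<noteq> \<mu> (Inr e')"
    and incident: "\<And>v e. v \<in> verts G \<Longrightarrow> e \<in> edges G \<Longrightarrow> v \<in> e \<Longrightarrow> \<mu> (Inl v) \<noteq> \<mu> (Inr e)"
    using assms(4) by (auto simp: is_sTC_def)
  show ?thesis
    unfolding is_sTC_def
  proof (intro conjI ballI impI)
    show "pullback fV fE \<mu> \<in> (verts G' <+> edges G') \<rightarrow> color_set (max_degree G')"
    proof
      fix x assume "x \<in> verts G' <+> edges G'"
      then show "pullback fV fE \<mu> x \<in> color_set (max_degree G')"
        using V E funcset_mem[OF range] by (elim PlusE) (simp_all add: deg InlI InrI)
    qed
  next
    fix e e' assume "e \<in> edges G'" "e' \<in> edges G'" "e \<noteq> e' \<and> e \<inter> e' \<noteq> {}"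
    then show "pullback fV fE \<mu> (Inr e) \<noteq> pullback fV fE \<mu> (Inr e')"
      using covering_edge_map_adjacent[OF G' cov] edges[OF E E] by simp
  next
    fix v e assume "v \<in> verts G'" "e \<in> edges G'" "v \<in> e"
    then show "pullback fV fE \<mu> (Inl v) \<noteq> pullback fV fE \<mu> (Inr e)"
      using incident[OF V E] covering_edge_map_eq_image[OF G' cov] by simp
  qed
qed

lemma is_TC_pullback:
  assumes "simple_graph G'" "covering_map G' G fV fE" "max_degree G' = max_degree G" "is_TC G \<mu>"
  shows "is_TC G' (pullback fV fE \<mu>)"
  unfolding is_TC_def
proof (intro conjI ballI impI)
  show "is_sTC G' (pullback fV fE \<mu>)"
    using is_sTC_pullback assms by (auto simp: is_TC_def)
next
  fix v w assume vw: "v \<in> verts G'" "w \<in> verts G'" "{v, w} \<in> edges G'"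
  then have "{fV v, fV w} \<in> edges G" "fV v \<in> verts G" "fV w \<in> verts G"
    using assms(2) unfolding covering_map_def by (metis imageI)+
  then show "pullback fV fE \<mu> (Inl v) \<noteq> pullback fV fE \<mu> (Inl w)"
    using assms(4) by (simp add: is_TC_def)
qed

text \<open>
  The image of an edge \<open>{x, y}\<close> has endvertices \<open>fV x\<close> and \<open>fV y\<close>, whose \<open>\<mu>\<close>-colours are the
  pulled-back colours of \<open>x\<close> and \<open>y\<close>; so an edge is a \<open>\<beta>\<close>-edge iff its image is one.
\<close>

lemma beta_pullback:
  assumes "simple_graph G" "simple_graph G'" "r_fold_covering_map r G' G fV fE"
  shows "beta G' (pullback fV fE \<mu>) = r * beta G \<mu>"
proof -
  have cov: "covering_map G' G fV fE"
    using assms(3) by (simp add: r_fold_covering_map_def)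
  have "e \<in> beta_edges G' (pullback fV fE \<mu>) \<longleftrightarrow> fE e \<in> beta_edges G \<mu>" if e: "e \<in> edges G'" for e
    using assms(2) e
  proof (rule simple_graph_edgeE)
    fix x y
    assume "e = {x, y}"
    moreover from this have "fE e = {fV x, fV y}"
      using covering_edge_map_eq_image[OF assms(2) cov e] by simp
    moreover have "fE e \<in> edges G"
      using cov e by (auto simp: covering_map_def)
    ultimately show ?thesis
      using e by (auto simp: beta_edges_def doubleton_eq_iff)
  qed
  then have "beta_edges G' (pullback fV fE \<mu>) = {e \<in> edges G'. fE e \<in> beta_edges G \<mu>}"
    unfolding beta_edges_def[of G'] by blast
  moreover have "card {e \<in> edges G'. fE e \<in> beta_edges G \<mu>} = r * card (beta_edges G \<mu>)"
    using assms finite_edges[OF assms(1)] finite_edges[OF assms(2)]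
    by (intro card_preimage_constant_fibres r_fold_covering_edge_fibres)
      (auto simp: beta_edges_def)
  ultimately show ?thesis
    by (simp add: beta_def)
qed

lemma card_color_class_pullback:
  assumes "simple_graph G" "simple_graph G'" "r_fold_covering_map r G' G fV fE"
  shows "card (color_class G' (pullback fV fE \<mu>) i) = r * card (color_class G \<mu> i)"
proof -
  let ?X = "verts G <+> edges G" and ?X' = "verts G' <+> edges G'" and ?f = "map_sum fV fE"
  have fin: "finite ?X" "finite ?X'"
    using assms(1,2) finite_edges by (auto simp: simple_graph_def)
  have "?f x \<in> ?X" if "x \<in> ?X'" for x
    using that assms(3) by (auto simp: r_fold_covering_map_def covering_map_def)
  then have "color_class G' (pullback fV fE \<mu>) i = {x \<in> ?X'. ?f x \<in> color_class G \<mu> i}"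
    by (auto simp: color_class_def pullback_def)
  moreover have "card {x \<in> ?X'. ?f x \<in> color_class G \<mu> i} = r * card (color_class G \<mu> i)"
  proof (rule card_preimage_constant_fibres)
    show "finite ?X'" "finite (color_class G \<mu> i)"
      using fin by (auto simp: color_class_def)
    fix y assume "y \<in> color_class G \<mu> i"
    then have "y \<in> ?X"
      by (simp add: color_class_def)
    then show "card {x \<in> ?X'. ?f x = y} = r"
    proof (elim PlusE)
      fix v assume v: "v \<in> verts G" "y = Inl v"
      have "{x \<in> ?X'. ?f x = y} = Inl ` {v' \<in> verts G'. fV v' = v}"
        using v by auto
      then show ?thesis
        using v assms(3) by (simp add: card_image r_fold_covering_map_def)
    next
      fix e assume e: "e \<in> edges G" "y = Inr e"
      have "{x \<in> ?X'. ?f x = y} = Inr ` {e' \<in> edges G'. fE e' = e}"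
        using e by auto
      then show ?thesis
        using r_fold_covering_edge_fibres[OF assms e(1)] by (simp add: card_image)
    qed
  qed
  ultimately show ?thesis
    by simp
qed

lemma finite_color_set: "finite (color_set D)" and color_set_nonempty: "color_set D \<noteq> {}"
  by (simp_all add: color_set_def)

lemma gamma_pullback:
  assumes "simple_graph G" "simple_graph G'" "r_fold_covering_map r G' G fV fE"
    and "max_degree G' = max_degree G"
  shows "gamma G' (pullback fV fE \<mu>) = r * gamma G \<mu>"
proof -
  let ?A = "(\<lambda>i. card (color_class G \<mu> i)) ` color_set (max_degree G)"
  have A: "finite ?A" "?A \<noteq> {}"
    by (simp_all add: finite_color_set color_set_nonempty)
  have "mono ((*) r)"
    by (simp add: mono_def)
  then have "Max ((*) r ` ?A) = r * Max ?A" "Min ((*) r ` ?A) = r * Min ?A"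
    using A mono_Max_commute[of "(*) r" ?A] mono_Min_commute[of "(*) r" ?A] by simp_all
  then show ?thesis
    by (simp add: gamma_def assms(4) card_color_class_pullback[OF assms(1-3)] image_image
        diff_mult_distrib2)
qed

lemma is_EqTC_if_gamma_eq_0:
  assumes "is_TC G \<mu>" "gamma G \<mu> = 0"
  shows "is_EqTC G \<mu>"
proof -
  let ?c = "\<lambda>i. card (color_class G \<mu> i)" and ?C = "color_set (max_degree G)"
  have "?c i \<le> ?c j" if "i \<in> ?C" "j \<in> ?C" for i j
  proof -
    have "?c i \<le> Max (?c ` ?C)"
      using that by (simp add: finite_color_set)
    also have "\<dots> \<le> Min (?c ` ?C)"
      using assms(2) by (simp add: gamma_def)
    also have "\<dots> \<le> ?c j"
      using that by (simp add: finite_color_set)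
    finally show ?thesis .
  qed
  then show ?thesis
    using assms(1) by (force simp: is_EqTC_def)
qed

theorem theorem19:
  fixes G :: "'a ugraph" and G' :: "'b ugraph"
    and fV :: "'b \<Rightarrow> 'a" and fE :: "'b set \<Rightarrow> 'a set"
    and \<Delta> r :: nat and \<mu> :: "'a coloring"
  assumes "simple_graph G" and "connected_graph G" and "max_degree G = \<Delta>"
    and "simple_graph G'" and "connected_graph G'" and "max_degree G' = \<Delta>"
    and "r > 0"
    and "r_fold_covering_map r G' G fV fE"
    and "is_sTC G \<mu>"
  shows "\<exists>\<mu>' :: 'b coloring.
           is_sTC G' \<mu>' \<and> is_lifting G' fV fE \<mu> \<mu>' \<and>
           beta G' \<mu>' = r * beta G \<mu> \<and>
           gamma G' \<mu>' = r * gamma G \<mu> \<and>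
           (is_TC G \<mu> \<longrightarrow> is_TC G' \<mu>') \<and>
           (is_EqTC G \<mu> \<and> gamma G \<mu> = 0 \<longrightarrow> is_EqTC G' \<mu>')"
proof (intro exI[of _ "pullback fV fE \<mu>"] conjI impI)
  note G = \<open>simple_graph G\<close> and G' = \<open>simple_graph G'\<close> and fold = \<open>r_fold_covering_map r G' G fV fE\<close>
  have cov: "covering_map G' G fV fE"
    using fold by (simp add: r_fold_covering_map_def)
  have deg: "max_degree G' = max_degree G"
    using \<open>max_degree G = \<Delta>\<close> \<open>max_degree G' = \<Delta>\<close> by simp
  show "is_sTC G' (pullback fV fE \<mu>)"
    using is_sTC_pullback[OF G' cov deg \<open>is_sTC G \<mu>\<close>] .
  show "is_lifting G' fV fE \<mu> (pullback fV fE \<mu>)"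
    by (simp add: is_lifting_def)
  show "beta G' (pullback fV fE \<mu>) = r * beta G \<mu>"
    using beta_pullback[OF G G' fold] .
  show gamma: "gamma G' (pullback fV fE \<mu>) = r * gamma G \<mu>"
    using gamma_pullback[OF G G' fold deg] .
  show TC: "is_TC G' (pullback fV fE \<mu>)" if "is_TC G \<mu>"
    using is_TC_pullback[OF G' cov deg that] .
  show "is_EqTC G' (pullback fV fE \<mu>)" if "is_EqTC G \<mu> \<and> gamma G \<mu> = 0"
    using that gamma TC by (intro is_EqTC_if_gamma_eq_0) (simp_all add: is_EqTC_def)
qed

end
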